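(* Let $\mathcal H$ be a real Hilbert space and $F=f+\Psi$, where $f:\mathcal H\to\mathbb R$ is convex and differentiable with $L$-Lipschitz continuous gradient for some $L>0$, and $\Psi:\mathcal H\to[-\infty,\infty]$ is convex, proper and closed. Let $\mathcal S=\{x:r(x)=0\}$ be nonempty, $F^*:=\min F$, and assume that for some $\kappa,\epsilon>0$, $$\operatorname{dist}(x,\mathcal S)\le\kappa\,r(x)\qquad\forall x\in\{x: r(x)\le\epsilon\}.$$ Let $\beta,\gamma\in(0,1)$ and $\delta>0$, and consider the line-search algorithm described in the context, in which the tentative points $\{\tilde x_{t+1}\}$ are generated in an arbitrary manner that satisfies $$\operatorname{dist}(\tilde x_{t+1},\mathcal S)=o(d_t)\quad\text{and}\quad r(\tilde x_{t+1})=o(r_t).$$ Assume also that $\|\tilde p_t\|^{2+\delta}=o(d_t^2)$. Then for all $t$ sufficiently large we have $\alpha_t=1$, and $$d_{t+1}=o(d_t),\qquad r_{t+1}=o(r_t),\qquad F(x_{t+1})-F^*=o\big(F(x_t)-F^*\big).$$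
   Context: Notation: $\operatorname{prox}_g(x)$ is the minimizer over $y\in\mathcal H$ of $\tfrac12\|y-x\|^2+g(y)$; $r(x):=\|x-\operatorname{prox}_\Psi(x-\nabla f(x))\|$; $\mathcal S=\{x:r(x)=0\}$ (the set of minimizers of $F$). Along the iterates, $r_t:=r(x_t)$, $d_t:=\operatorname{dist}(x_t,\mathcal S)$. Algorithm. Input $x_0\in\mathcal H$. For $t=0,1,\dots$: given $x_t$ and a tentative point $\tilde x_{t+1}$, set $\tilde p_t:=\tilde x_{t+1}-x_t$ and terminate if $\tilde p_t=0$. For $\alpha>0$ let $y_{t+1}(\alpha):=x_t+\alpha\tilde p_t$ and $\bar x_{t+1}(\alpha):=\operatorname{prox}_{\Psi/L}\big(y_{t+1}(\alpha)-\tfrac1L\nabla f(y_{t+1}(\alpha))\big)$. Starting with $\alpha_t=1$, replace $\alpha_t$ by $\beta\alpha_t$ until $$F(\bar x_{t+1}(\alpha_t))\le F(x_t)-\gamma\alpha_t^2\|\tilde p_t\|^{2+\delta};$$ then set $x_{t+1}:=\bar x_{t+1}(\alpha_t)$. The algorithm is assumed to generate an infinite sequence. $\sigma_t=o(\tau_t)$ means: for every $\beta'>0$, $\sigma_t\le\beta'\tau_t$ for all $t$ sufficiently large. *)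

theory Defs
  imports "HOL-Analysis.Analysis"
begin

text \<open>Extended-valued functions are convex, resp. closed, when their epigraph is.\<close>

definition ereal_epigraph :: "('a \<Rightarrow> ereal) \<Rightarrow> ('a \<times> real) set" where
  "ereal_epigraph g = {(x, u). g x \<le> ereal u}"

definition ereal_convex :: "('a::real_vector \<Rightarrow> ereal) \<Rightarrow> bool" where
  "ereal_convex g \<longleftrightarrow> convex (ereal_epigraph g)"

definition ereal_closed :: "('a::topological_space \<Rightarrow> ereal) \<Rightarrow> bool" where
  "ereal_closed g \<longleftrightarrow> closed (ereal_epigraph g)"

definition ereal_proper :: "('a \<Rightarrow> ereal) \<Rightarrow> bool" where
  "ereal_proper g \<longleftrightarrow> (\<forall>x. g x \<noteq> -\<infinity>) \<and> (\<exists>x. g x \<noteq> \<infinity>)"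

definition prox :: "('a::real_inner \<Rightarrow> ereal) \<Rightarrow> 'a \<Rightarrow> 'a" where
  "prox g x = (ARG_MIN (\<lambda>y. ereal (1/2 * (norm (y - x))\<^sup>2) + g y) y. True)"

definition objective :: "('a \<Rightarrow> real) \<Rightarrow> ('a \<Rightarrow> ereal) \<Rightarrow> 'a \<Rightarrow> ereal" where
  "objective f \<Psi> x = ereal (f x) + \<Psi> x"

text \<open>In the following, \<open>G\<close> is the gradient of the smooth part \<open>f\<close>.\<close>

definition residual :: "('a::real_inner \<Rightarrow> 'a) \<Rightarrow> ('a \<Rightarrow> ereal) \<Rightarrow> 'a \<Rightarrow> real" where
  "residual G \<Psi> x = norm (x - prox \<Psi> (x - G x))"

definition solution_set :: "('a::real_inner \<Rightarrow> 'a) \<Rightarrow> ('a \<Rightarrow> ereal) \<Rightarrow> 'a set" where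
  "solution_set G \<Psi> = {x. residual G \<Psi> x = 0}"

definition prox_grad_step ::
    "('a::real_inner \<Rightarrow> 'a) \<Rightarrow> ('a \<Rightarrow> ereal) \<Rightarrow> real \<Rightarrow> 'a \<Rightarrow> 'a" where
  "prox_grad_step G \<Psi> L y = prox (\<lambda>z. \<Psi> z / ereal L) (y - (1/L) *\<^sub>R G y)"

text \<open>\<open>trial_point G \<Psi> L x p a\<close> is the candidate next iterate for step size \<open>a\<close> along \<open>p\<close>.\<close>

definition trial_point ::
    "('a::real_inner \<Rightarrow> 'a) \<Rightarrow> ('a \<Rightarrow> ereal) \<Rightarrow> real \<Rightarrow> 'a \<Rightarrow> 'a \<Rightarrow> real \<Rightarrow> 'a" where
  "trial_point G \<Psi> L x p a = prox_grad_step G \<Psi> L (x + a *\<^sub>R p)"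

definition step_accepted ::
    "('a::real_inner \<Rightarrow> real) \<Rightarrow> ('a \<Rightarrow> 'a) \<Rightarrow> ('a \<Rightarrow> ereal) \<Rightarrow> real \<Rightarrow> real \<Rightarrow> real
      \<Rightarrow> 'a \<Rightarrow> 'a \<Rightarrow> real \<Rightarrow> bool" where
  "step_accepted f G \<Psi> L \<gamma> \<delta> x p a \<longleftrightarrow>
     objective f \<Psi> (trial_point G \<Psi> L x p a)
       \<le> objective f \<Psi> x - ereal (\<gamma> * a\<^sup>2 * norm p powr (2 + \<delta>))"

text \<open>
  An infinite run: the termination test never succeeds and every backtracking loop stops,
  at the first accepted power of \<open>\<beta>\<close>. The tentative point produced in iteration \<open>t\<close> is
  \<open>xt (Suc t)\<close>; the value \<open>xt 0\<close> is not used.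
\<close>

definition line_search_run ::
    "('a::real_inner \<Rightarrow> real) \<Rightarrow> ('a \<Rightarrow> 'a) \<Rightarrow> ('a \<Rightarrow> ereal) \<Rightarrow> real \<Rightarrow> real \<Rightarrow> real \<Rightarrow> real
      \<Rightarrow> (nat \<Rightarrow> 'a) \<Rightarrow> (nat \<Rightarrow> 'a) \<Rightarrow> (nat \<Rightarrow> real) \<Rightarrow> bool" where
  "line_search_run f G \<Psi> L \<beta> \<gamma> \<delta> x xt \<alpha> \<longleftrightarrow>
     (\<forall>t. let p = xt (Suc t) - x t in
        p \<noteq> 0 \<and>
        (\<exists>k. \<alpha> t = \<beta> ^ k \<and>
             step_accepted f G \<Psi> L \<gamma> \<delta> (x t) p (\<beta> ^ k) \<and>
             (\<forall>j<k. \<not> step_accepted f G \<Psi> L \<gamma> \<delta> (x t) p (\<beta> ^ j))) \<and>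
        x (Suc t) = trial_point G \<Psi> L (x t) p (\<alpha> t))"

text \<open>
  The relation \<open>\<sigma>\<^sub>t = o(\<tau>\<^sub>t)\<close> for nonnegative sequences. It is extended-valued
  because the initial objective value may be infinite.
\<close>

definition little_o :: "(nat \<Rightarrow> ereal) \<Rightarrow> (nat \<Rightarrow> ereal) \<Rightarrow> bool" where
  "little_o \<sigma> \<tau> \<longleftrightarrow> (\<forall>c::real. c > 0 \<longrightarrow> (\<forall>\<^sub>F t in sequentially. \<sigma> t \<le> ereal c * \<tau> t))"

end

theory Submission
  imports Defs
begin

text \<open>
  Write \<open>T\<close> for the proximal gradient step of length \<open>1/L\<close>. The three-point inequality
  \<open>F (T y) + L/2 * norm (z - T y)\<^sup>2 \<le> F z + L/2 * norm (y - z)\<^sup>2\<close> with a solution \<open>z\<close> near \<open>y\<close> gives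
  \<open>F (T y) - F* \<le> L/2 * dist(y, S)\<^sup>2\<close> and \<open>dist(T y, S) \<le> dist(y, S)\<close>; with \<open>z = y\<close> it gives
  \<open>F y - F* \<ge> L/2 * norm (y - T y)\<^sup>2\<close>, and \<open>norm (y - T y)\<close> dominates a multiple of \<open>r y\<close>. Under the
  error bound, the objective gap at \<open>x\<^sub>t\<close> is therefore at least a multiple of \<open>d\<^sub>t\<^sup>2\<close>, whereas at
  \<open>T\<close> of the tentative point it is \<open>o(d\<^sub>t\<^sup>2)\<close>, so the unit step is eventually accepted. The error
  bound applies for large \<open>t\<close> because \<open>d\<^sub>t \<le> 2 * norm p\<^sub>t\<close> eventually, so that
  \<open>norm p\<^sub>t powr (2 + \<delta>) = o(d\<^sub>t\<^sup>2)\<close> forces \<open>p\<^sub>t\<close>, and with it \<open>d\<^sub>t\<close> and \<open>r\<^sub>t\<close>, to tend to \<open>0\<close>.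
\<close>

section \<open>Lower bounds for closed convex functions, and existence of the proximal point\<close>

lemma ereal_convexD:
  assumes "ereal_convex g" "g x \<le> ereal a" "g y \<le> ereal b" "0 \<le> t" "t \<le> 1"
  shows "g ((1 - t) *\<^sub>R x + t *\<^sub>R y) \<le> ereal ((1 - t) * a + t * b)"
proof -
  have "(1 - t) *\<^sub>R (x, a) + t *\<^sub>R (y, b) \<in> ereal_epigraph g"
    using assms unfolding ereal_convex_def by (intro convexD) (auto simp: ereal_epigraph_def)
  then show ?thesis
    by (simp add: ereal_epigraph_def)
qed

text \<open>Makes the proximal objective bounded below: the quadratic term outgrows a loss that is
  at most linear. A bound by a cone with apex over \<open>y0\<close> suffices, so no separating
  hyperplane has to be constructed.\<close>

lemma closed_convex_proper_affine_minorant: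
  fixes g :: "'a::real_normed_vector \<Rightarrow> ereal"
  assumes "ereal_convex g" "ereal_closed g" "ereal_proper g"
  shows "\<exists>y0 a b. b \<ge> 0 \<and> (\<forall>y. ereal (a - b * norm (y - y0)) \<le> g y)"
proof -
  obtain y0 c where c: "g y0 = ereal c"
    using assms(3) unfolding ereal_proper_def by (metis ereal_cases)
  have "open (- ereal_epigraph g)"
    using assms(2) by (simp add: ereal_closed_def open_Compl)
  moreover have "(y0, c - 1) \<in> - ereal_epigraph g"
    by (simp add: ereal_epigraph_def c)
  ultimately obtain e where e: "e > 0"
    "\<And>z. dist z (y0, c - 1) < e \<Longrightarrow> z \<in> - ereal_epigraph g"
    by (metis open_dist)
  \<comment> \<open>\<open>g > c - 1\<close> near \<open>y0\<close>; convexity along rays from \<open>y0\<close> extends this to a linear bound.\<close>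
  define \<rho> where "\<rho> = e / 2"
  have \<rho>: "\<rho> > 0"
    using e by (simp add: \<rho>_def)
  have near: "ereal (c - 1) < g y" if "norm (y - y0) \<le> \<rho>" for y
    using e(2)[of "(y, c - 1)"] that e(1)
    by (simp add: dist_Pair_Pair dist_norm ereal_epigraph_def \<rho>_def not_le)
  have "ereal (c - 1 - 1 / \<rho> * norm (y - y0)) \<le> g y" for y
  proof (cases "norm (y - y0) \<le> \<rho>")
    case True
    have "c - 1 - 1 / \<rho> * norm (y - y0) \<le> c - 1"
      using \<rho> by simp
    then show ?thesis
      using near[OF True] by (meson ereal_less_eq(3) le_less_trans less_imp_le)
  next
    case False
    define s where "s = norm (y - y0)"
    have s: "s > \<rho>" "s > 0"
      using False \<rho> by (auto simp: s_def)
    show ?thesis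
    proof (rule ccontr)
      assume "\<not> ?thesis"
      then have "g y \<le> ereal (c - 1 - s / \<rho>)"
        by (simp add: s_def)
      from ereal_convexD[OF assms(1) _ this, of y0 c "\<rho> / s"]
      have "g ((1 - \<rho> / s) *\<^sub>R y0 + (\<rho> / s) *\<^sub>R y)
          \<le> ereal ((1 - \<rho> / s) * c + \<rho> / s * (c - 1 - s / \<rho>))"
        using s \<rho> by (simp add: c)
      moreover have "(1 - \<rho> / s) * c + \<rho> / s * (c - 1 - s / \<rho>) = c - 1 - \<rho> / s"
        using s \<rho> by (simp add: field_simps)
      moreover have "(1 - \<rho> / s) *\<^sub>R y0 + (\<rho> / s) *\<^sub>R y - y0 = (\<rho> / s) *\<^sub>R (y - y0)"
        by (simp add: algebra_simps)
      then have "norm ((1 - \<rho> / s) *\<^sub>R y0 + (\<rho> / s) *\<^sub>R y - y0) \<le> \<rho>"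
        using s \<rho> by (simp add: s_def[symmetric])
      from near[OF this] have "ereal (c - 1) < g ((1 - \<rho> / s) *\<^sub>R y0 + (\<rho> / s) *\<^sub>R y)" .
      ultimately have "ereal (c - 1) < ereal (c - 1 - \<rho> / s)"
        by (metis less_le_trans)
      then show False
        using divide_pos_pos[OF \<rho> s(2)] by simp
    qed
  qed
  with \<rho> show ?thesis
    by (intro exI[of _ y0] exI[of _ "c - 1"] exI[of _ "1 / \<rho>"]) simp
qed

text \<open>\<open>prox\<close> is a choice term and says something only once a minimizer exists. A
  minimizing sequence is Cauchy by strong convexity, and closedness of the epigraph carries its
  bounds to the limit.\<close>

lemma prox_is_arg_min:
  fixes g :: "'a::{real_inner, complete_space} \<Rightarrow> ereal"
  assumes conv: "ereal_convex g" and clsd: "ereal_closed g" and proper: "ereal_proper g"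
  shows "is_arg_min (\<lambda>y. ereal (1/2 * (norm (y - u))\<^sup>2) + g y) (\<lambda>_. True) (prox g u)"
proof -
  obtain y0 a b where b: "b \<ge> 0" and minorant: "\<And>y. ereal (a - b * norm (y - y0)) \<le> g y"
    using closed_convex_proper_affine_minorant[OF conv clsd proper] by auto
  \<comment> \<open>Ranging over real upper bounds \<open>c\<close> of \<open>g y\<close> gives a
    set of reals with the same infimum as the extended-valued objective.\<close>
  define A where "A = {1/2 * (norm (y - u))\<^sup>2 + c |y c. g y \<le> ereal c}"
  obtain y1 c1 where "g y1 = ereal c1"
    using proper unfolding ereal_proper_def by (metis ereal_cases)
  then have "A \<noteq> {}"
    unfolding A_def by (auto intro!: exI[of _ y1] exI[of _ c1])
  have "bdd_below A"
  proof (rule bdd_belowI)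
    fix v
    assume "v \<in> A"
    then obtain y c where v: "v = 1/2 * (norm (y - u))\<^sup>2 + c" and "g y \<le> ereal c"
      by (auto simp: A_def)
    with minorant[of y] have "a - b * norm (y - y0) \<le> c"
      by (meson ereal_less_eq(3) order_trans)
    moreover have "b * norm (y - y0) \<le> b * (norm (y - u) + norm (u - y0))"
      using b norm_triangle_ineq[of "y - u" "u - y0"] by (intro mult_left_mono) auto
    \<comment> \<open>With s = \<open>norm (y - u)\<close>, this gives s^2/2 - b*s at least -b^2/2,
      so the quadratic term absorbs the linear one.\<close>
    moreover have "0 \<le> (norm (y - u) - b)\<^sup>2"
      by simp
    ultimately show "a - b * norm (u - y0) - b\<^sup>2 / 2 \<le> v"
      unfolding v by (simp add: power2_diff algebra_simps)
  qed
  define m where "m = Inf A"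
  have m_le: "m \<le> 1/2 * (norm (y - u))\<^sup>2 + c" if "g y \<le> ereal c" for y c
    unfolding m_def using that \<open>bdd_below A\<close> by (intro cInf_lower) (auto simp: A_def)
  have "\<exists>y c. g y \<le> ereal c \<and> 1/2 * (norm (y - u))\<^sup>2 + c < m + inverse (Suc n)" for n
  proof -
    have "\<exists>v\<in>A. v < m + inverse (Suc n)"
      using cInf_lessD[OF \<open>A \<noteq> {}\<close>, of "m + inverse (Suc n)"] by (simp add: m_def)
    then show ?thesis
      by (auto simp: A_def)
  qed
  then obtain y c where yc: "\<And>n. g (y n) \<le> ereal (c n)"
    "\<And>n. 1/2 * (norm (y n - u))\<^sup>2 + c n < m + inverse (Suc n)"
    by metis
  \<comment> \<open>Strong convexity: comparing \<open>m\<close> with the midpoint makes the minimizing sequence Cauchy.\<close>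
  have gap: "(norm (y i - y j))\<^sup>2 \<le> 4 * (inverse (Suc i) + inverse (Suc j))" for i j
  proof -
    have "m \<le> 1/2 * (norm ((1 - 1/2) *\<^sub>R y i + (1/2) *\<^sub>R y j - u))\<^sup>2 + ((1 - 1/2) * c i + 1/2 * c j)"
      by (intro m_le ereal_convexD[OF conv] yc) auto
    moreover have "(norm ((1 - 1/2) *\<^sub>R y i + (1/2) *\<^sub>R y j - u))\<^sup>2
        = 1/2 * (norm (y i - u))\<^sup>2 + 1/2 * (norm (y j - u))\<^sup>2 - 1/4 * (norm (y i - y j))\<^sup>2"
      unfolding power2_norm_eq_inner by (simp add: inner_simps inner_commute algebra_simps)
    ultimately show ?thesis
      using yc(2)[of i] yc(2)[of j] by argo
  qed
  have "Cauchy y"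
  proof (rule metric_CauchyI)
    fix e :: real
    assume "e > 0"
    \<comment> \<open>Two summands below e^2/8, multiplied by the factor 4 in \<open>gap\<close>,
      stay below e^2.\<close>
    then obtain N where N: "inverse (real (Suc N)) < e\<^sup>2 / 8"
      using reals_Archimedean[of "e\<^sup>2 / 8"] by auto
    have "dist (y i) (y j) < e" if "i \<ge> N" "j \<ge> N" for i j
    proof -
      have "inverse (real (Suc i)) \<le> inverse (Suc N)" "inverse (real (Suc j)) \<le> inverse (Suc N)"
        using that by (auto intro!: le_imp_inverse_le)
      with gap[of i j] N have "(norm (y i - y j))\<^sup>2 < e\<^sup>2"
        by argo
      then show ?thesis
        using \<open>e > 0\<close> by (simp add: dist_norm power2_less_imp_less)
    qed
    then show "\<exists>N. \<forall>i\<ge>N. \<forall>j\<ge>N. dist (y i) (y j) < e"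
      by blast
  qed
  then obtain p where p: "y \<longlonglongrightarrow> p"
    using Cauchy_convergent convergent_def by blast
  \<comment> \<open>The heights \<open>c n\<close> are raised to an upper bound whose limit can be
    read off from that of \<open>y\<close>.\<close>
  define w where "w n = (y n, m + inverse (Suc n) - 1/2 * (norm (y n - u))\<^sup>2)" for n
  have "w n \<in> ereal_epigraph g" for n
    using yc(1)[of n] yc(2)[of n]
    by (auto simp: w_def ereal_epigraph_def intro: order_trans)
  moreover have "w \<longlonglongrightarrow> (p, m + 0 - 1/2 * (norm (p - u))\<^sup>2)"
    unfolding w_def by (intro tendsto_intros p LIMSEQ_inverse_real_of_nat)
  ultimately have "(p, m + 0 - 1/2 * (norm (p - u))\<^sup>2) \<in> ereal_epigraph g"
    using clsd unfolding ereal_closed_def by (meson closed_sequentially)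
  then have "g p \<le> ereal (m - 1/2 * (norm (p - u))\<^sup>2)"
    by (simp add: ereal_epigraph_def)
  then have p_le: "ereal (1/2 * (norm (p - u))\<^sup>2) + g p \<le> ereal m"
    by (cases "g p") auto
  have "ereal m \<le> ereal (1/2 * (norm (z - u))\<^sup>2) + g z" for z
    using m_le[of z] proper by (cases "g z") (auto simp: ereal_proper_def)
  with p_le have "is_arg_min (\<lambda>y. ereal (1/2 * (norm (y - u))\<^sup>2) + g y) (\<lambda>_. True) p"
    unfolding is_arg_min_def by (meson not_le order_trans)
  then show ?thesis
    unfolding prox_def arg_min_def by (rule someI)
qed

lemma prox_finite:
  fixes g :: "'a::{real_inner, complete_space} \<Rightarrow> ereal"
  assumes "ereal_convex g" "ereal_closed g" "ereal_proper g"
  shows "\<bar>g (prox g u)\<bar> \<noteq> \<infinity>"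
proof -
  obtain w where "g w \<noteq> \<infinity>"
    using assms(3) by (auto simp: ereal_proper_def)
  moreover have "ereal (1/2 * (norm (prox g u - u))\<^sup>2) + g (prox g u)
      \<le> ereal (1/2 * (norm (w - u))\<^sup>2) + g w"
    using prox_is_arg_min[OF assms, of u] by (simp add: is_arg_min_linorder)
  ultimately show ?thesis
    using assms(3) by (auto simp: ereal_proper_def)
qed

text \<open>First-order optimality: the minimizer is compared with points at parameter t on the
  segment towards \<open>w\<close>. The leftover quadratic term is of order t^2, so it vanishes
  after division by t as t tends to 0 from above.\<close>

lemma prox_subgradient:
  fixes g :: "'a::{real_inner, complete_space} \<Rightarrow> ereal"
  assumes "ereal_convex g" "ereal_closed g" "ereal_proper g"
  shows "g (prox g u) + ereal ((u - prox g u) \<bullet> (w - prox g u)) \<le> g w"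
proof -
  define p where "p = prox g u"
  obtain a where a: "g p = ereal a"
    using prox_finite[OF assms, of u] by (auto simp: p_def)
  have min: "ereal (1/2 * (norm (p - u))\<^sup>2) + g p \<le> ereal (1/2 * (norm (z - u))\<^sup>2) + g z" for z
    using prox_is_arg_min[OF assms, of u] by (simp add: is_arg_min_linorder p_def)
  have "a + (u - p) \<bullet> (w - p) \<le> b" if b: "g w = ereal b" for b
  proof -
    have "a + (u - p) \<bullet> (w - p) - b \<le> t / 2 * (norm (w - p))\<^sup>2" if t: "0 < t" "t < 1" for t
    proof -
      let ?z = "(1 - t) *\<^sub>R p + t *\<^sub>R w"
      have "g ?z \<le> ereal ((1 - t) * a + t * b)"
        using t a b by (intro ereal_convexD[OF assms(1)]) auto
      then have "ereal (1/2 * (norm (?z - u))\<^sup>2) + g ?z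
          \<le> ereal (1/2 * (norm (?z - u))\<^sup>2) + ereal ((1 - t) * a + t * b)"
        by (rule add_left_mono)
      with min[of ?z] have "1/2 * (norm (p - u))\<^sup>2 + a \<le> 1/2 * (norm (?z - u))\<^sup>2 + ((1 - t) * a + t * b)"
        unfolding a using order_trans by fastforce
      moreover have "?z - u = (p - u) + t *\<^sub>R (w - p)"
        by (simp add: algebra_simps)
      then have "(norm (?z - u))\<^sup>2 = (norm (p - u))\<^sup>2 - 2 * t * ((u - p) \<bullet> (w - p)) + t\<^sup>2 * (norm (w - p))\<^sup>2"
        unfolding power2_norm_eq_inner
        by (simp add: inner_simps inner_commute algebra_simps power2_eq_square)
      ultimately have "t * (a + (u - p) \<bullet> (w - p) - b) \<le> t * (t / 2 * (norm (w - p))\<^sup>2)"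
        by (simp add: algebra_simps power2_eq_square)
      then show ?thesis
        using t by simp
    qed
    then have "\<forall>\<^sub>F t in at_right 0. a + (u - p) \<bullet> (w - p) - b \<le> t / 2 * (norm (w - p))\<^sup>2"
      unfolding eventually_at_right_field by (intro exI[of _ 1]) auto
    moreover have "((\<lambda>t. t / 2 * (norm (w - p))\<^sup>2) \<longlongrightarrow> 0 / 2 * (norm (w - p))\<^sup>2) (at_right 0)"
      by (intro tendsto_intros) auto
    ultimately have "a + (u - p) \<bullet> (w - p) - b \<le> 0 / 2 * (norm (w - p))\<^sup>2"
      by (intro tendsto_lowerbound) auto
    then show ?thesis
      by simp
  qed
  then show ?thesis
    using assms(3) a unfolding p_def[symmetric] by (cases "g w") (auto simp: ereal_proper_def)
qed

section \<open>Scaling an extended-valued function by a positive constant\<close>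

lemma ereal_epigraph_divide:
  assumes "c > 0"
  shows "ereal_epigraph (\<lambda>z. g z / ereal c) = (\<lambda>(z, v). (z, c * v)) -` ereal_epigraph g"
  using assms by (auto simp: ereal_epigraph_def ereal_divide_le_pos mult.commute)

lemma ereal_convex_divide:
  assumes "ereal_convex g" "c > 0"
  shows "ereal_convex (\<lambda>z. g z / ereal c)"
proof -
  have "linear (\<lambda>(z::'a, v). (z, c * v))"
    by (rule linearI) (auto simp: algebra_simps)
  then show ?thesis
    using assms unfolding ereal_convex_def ereal_epigraph_divide[OF assms(2)]
    by (intro convex_linear_vimage)
qed

lemma ereal_closed_divide:
  assumes "ereal_closed g" "c > 0"
  shows "ereal_closed (\<lambda>z. g z / ereal c)"
  using assms(1) unfolding ereal_closed_def ereal_epigraph_divide[OF assms(2)]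
  by (intro closed_vimage) (auto simp: case_prod_unfold intro!: continuous_intros)

lemma ereal_proper_divide:
  assumes "ereal_proper g" "c > 0"
  shows "ereal_proper (\<lambda>z. g z / ereal c)"
proof -
  have "g z / ereal c = \<infinity> \<longleftrightarrow> g z = \<infinity>" "g z / ereal c = -\<infinity> \<longleftrightarrow> g z = -\<infinity>" for z
    using assms(2) by (cases "g z"; simp)+
  with assms(1) show ?thesis
    by (simp add: ereal_proper_def)
qed

section \<open>Smooth convex functions: tangent and quadratic bounds\<close>

lemma has_field_derivative_along_line:
  assumes "GDERIV f (x + t *\<^sub>R h) :> D"
  shows "((\<lambda>s. f (x + s *\<^sub>R h)) has_field_derivative (D \<bullet> h)) (at t)"
proof -
  have "((\<lambda>s. x + s *\<^sub>R h) has_derivative (\<lambda>s. s *\<^sub>R h)) (at t)"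
    by (auto intro!: derivative_eq_intros)
  from diff_chain_at[OF this assms[unfolded gderiv_def]]
  have "((\<lambda>s. f (x + s *\<^sub>R h)) has_derivative (\<lambda>s. (s *\<^sub>R h) \<bullet> D)) (at t)"
    by (simp add: o_def)
  then show ?thesis
    unfolding has_field_derivative_def by (rule has_derivative_eq_rhs) (auto simp: inner_commute)
qed

lemma convex_on_ge_linearization:
  assumes "convex_on UNIV f" "GDERIV f y :> D"
  shows "f y + D \<bullet> (w - y) \<le> f w"
proof -
  let ?\<phi> = "\<lambda>s. f (y + s *\<^sub>R (w - y))"
  have "convex_on UNIV ?\<phi>"
  proof (rule convex_onI)
    fix t a b :: real
    assume "0 < t" "t < 1"
    then have "f ((1 - t) *\<^sub>R (y + a *\<^sub>R (w - y)) + t *\<^sub>R (y + b *\<^sub>R (w - y))) \<le> (1 - t) * ?\<phi> a + t * ?\<phi> b"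
      using convex_onD[OF assms(1)] by auto
    moreover have "(1 - t) *\<^sub>R (y + a *\<^sub>R (w - y)) + t *\<^sub>R (y + b *\<^sub>R (w - y))
        = y + ((1 - t) *\<^sub>R a + t *\<^sub>R b) *\<^sub>R (w - y)"
      by (simp add: algebra_simps)
    ultimately show "?\<phi> ((1 - t) *\<^sub>R a + t *\<^sub>R b) \<le> (1 - t) * ?\<phi> a + t * ?\<phi> b"
      by simp
  qed simp
  moreover have "(?\<phi> has_field_derivative (D \<bullet> (w - y))) (at 0)"
    using assms(2) by (intro has_field_derivative_along_line) simp
  ultimately have "?\<phi> 1 - ?\<phi> 0 \<ge> (D \<bullet> (w - y)) * (1 - 0)"
    by (intro convex_on_imp_above_tangent[where A = UNIV]) auto
  then show ?thesis
    by simp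
qed

text \<open>The descent lemma. Along the segment, \<open>f\<close> minus the proposed bound has
  nonpositive derivative by Cauchy-Schwarz and the Lipschitz condition, so monotonicity replaces
  integration of the gradient.\<close>

lemma lipschitz_gradient_le:
  assumes grad: "\<And>z. GDERIV f z :> G z" and lip: "L-lipschitz_on UNIV G"
  shows "f w \<le> f y + G y \<bullet> (w - y) + L / 2 * (norm (w - y))\<^sup>2"
proof -
  let ?h = "w - y"
  let ?\<phi> = "\<lambda>s. f (y + s *\<^sub>R ?h) - s * (G y \<bullet> ?h) - L / 2 * s\<^sup>2 * (norm ?h)\<^sup>2"
  have "?\<phi> 1 \<le> ?\<phi> 0"
  proof (rule DERIV_nonpos_imp_nonincreasing[of 0 1 ?\<phi>])
    fix s :: real
    assume "0 \<le> s" "s \<le> 1"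
    have "(?\<phi> has_field_derivative (G (y + s *\<^sub>R ?h) \<bullet> ?h - G y \<bullet> ?h - L * s * (norm ?h)\<^sup>2)) (at s)"
      by (auto intro!: derivative_eq_intros has_field_derivative_along_line[OF grad])
    moreover have "G (y + s *\<^sub>R ?h) \<bullet> ?h - G y \<bullet> ?h \<le> L * s * (norm ?h)\<^sup>2"
    proof -
      have "G (y + s *\<^sub>R ?h) \<bullet> ?h - G y \<bullet> ?h \<le> norm (G (y + s *\<^sub>R ?h) - G y) * norm ?h"
        unfolding inner_diff_left[symmetric] by (rule norm_cauchy_schwarz)
      also have "\<dots> \<le> L * norm (s *\<^sub>R ?h) * norm ?h"
        using lipschitz_onD[OF lip, of "y + s *\<^sub>R ?h" y]
        by (intro mult_right_mono) (auto simp: dist_norm)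
      finally show ?thesis
        using \<open>0 \<le> s\<close> by (simp add: power2_eq_square mult_ac)
    qed
    ultimately show "\<exists>D. (?\<phi> has_field_derivative D) (at s) \<and> D \<le> 0"
      by (meson diff_le_0_iff_le)
  qed simp
  then show ?thesis
    by simp
qed

text \<open>Stands in for a projection onto the solution set: instead of a nearest point, one within
  a strictly larger distance is taken.\<close>

lemma infdist_lessE:
  assumes "infdist y A < e" "A \<noteq> {}"
  obtains z where "z \<in> A" "dist y z < e"
  using assms unfolding infdist_notempty[OF assms(2)]
  by (subst (asm) cINF_less_iff) (auto intro: that bdd_belowI2[where m = 0])

section \<open>Inequalities for the proximal gradient step, the residual and the solutions\<close>

locale convex_composite =
  fixes f :: "'a::{real_inner, complete_space} \<Rightarrow> real"
    and G :: "'a \<Rightarrow> 'a"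
    and \<Psi> :: "'a \<Rightarrow> ereal"
    and L :: real
  assumes f_convex: "convex_on UNIV f"
    and f_gradient: "\<And>z. GDERIV f z :> G z"
    and L_pos: "L > 0"
    and G_lipschitz: "L-lipschitz_on UNIV G"
    and \<Psi>_convex: "ereal_convex \<Psi>"
    and \<Psi>_proper: "ereal_proper \<Psi>"
    and \<Psi>_closed: "ereal_closed \<Psi>"
begin

lemma prox_grad_step_finite:
  assumes "c > 0"
  shows "\<bar>\<Psi> (prox_grad_step G \<Psi> c y)\<bar> \<noteq> \<infinity>"
proof -
  let ?p = "prox_grad_step G \<Psi> c y"
  have "\<bar>\<Psi> ?p / ereal c\<bar> \<noteq> \<infinity>"
    unfolding prox_grad_step_def
    using assms \<Psi>_convex \<Psi>_closed \<Psi>_proper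
    by (intro prox_finite ereal_convex_divide ereal_closed_divide ereal_proper_divide)
  then show ?thesis
    using assms by (cases "\<Psi> ?p") auto
qed

text \<open>Multiplying the optimality condition by \<open>c\<close> undoes the division inside
  \<open>prox_grad_step\<close>. The parameter stays general because \<open>c = 1\<close> yields the
  map behind \<open>residual\<close> and \<open>c = L\<close> the step of the algorithm.\<close>

lemma prox_grad_step_subgradient:
  assumes "c > 0"
  shows "\<Psi> (prox_grad_step G \<Psi> c y)
      + ereal ((c *\<^sub>R (y - prox_grad_step G \<Psi> c y) - G y) \<bullet> (w - prox_grad_step G \<Psi> c y)) \<le> \<Psi> w"
proof -
  define p where "p = prox_grad_step G \<Psi> c y"
  obtain a where a: "\<Psi> p = ereal a"
    using prox_grad_step_finite[OF assms, of y] by (auto simp: p_def)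
  define s where "s = (y - (1 / c) *\<^sub>R G y - p) \<bullet> (w - p)"
  have "\<Psi> p / ereal c + ereal s \<le> \<Psi> w / ereal c"
    unfolding prox_grad_step_def p_def s_def
    using assms \<Psi>_convex \<Psi>_closed \<Psi>_proper
    by (intro prox_subgradient[of "\<lambda>z. \<Psi> z / ereal c"]
        ereal_convex_divide ereal_closed_divide ereal_proper_divide)
  then have "a + c * s \<le> b" if "\<Psi> w = ereal b" for b
    using mult_left_mono[of "a / c + s" "b / c" c] assms a that by (simp add: distrib_left)
  moreover have "c *\<^sub>R (y - p) - G y = c *\<^sub>R (y - (1 / c) *\<^sub>R G y - p)"
    using assms by (simp add: algebra_simps)
  then have "(c *\<^sub>R (y - p) - G y) \<bullet> (w - p) = c * s"
    by (simp add: s_def)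
  ultimately show ?thesis
    using a \<Psi>_proper unfolding p_def[symmetric]
    by (cases "\<Psi> w") (auto simp: ereal_proper_def)
qed

lemma residual_eq: "residual G \<Psi> x = norm (x - prox_grad_step G \<Psi> 1 x)"
proof -
  have "\<Psi> z / ereal 1 = \<Psi> z" for z
    by (cases "\<Psi> z") auto
  then show ?thesis
    by (simp add: residual_def prox_grad_step_def)
qed

lemma solution_set_iff: "z \<in> solution_set G \<Psi> \<longleftrightarrow> prox_grad_step G \<Psi> 1 z = z"
  by (auto simp: solution_set_def residual_eq)

text \<open>The sum of three bounds: the subgradient inequality for \<Psi> at the new point, the
  descent lemma from \<open>y\<close>, and the tangent inequality for \<open>f\<close> from
  \<open>y\<close> to \<open>z\<close>. The gradient terms cancel, and the rest is the expansion of
  the square of y - z = (y - p) - (z - p).\<close>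

lemma objective_prox_grad_step_le:
  "objective f \<Psi> (prox_grad_step G \<Psi> L y) + ereal (L / 2 * (norm (z - prox_grad_step G \<Psi> L y))\<^sup>2)
    \<le> objective f \<Psi> z + ereal (L / 2 * (norm (y - z))\<^sup>2)"
proof -
  define p where "p = prox_grad_step G \<Psi> L y"
  obtain a where a: "\<Psi> p = ereal a"
    using prox_grad_step_finite[OF L_pos, of y] by (auto simp: p_def)
  have "f p + a + L / 2 * (norm (z - p))\<^sup>2 \<le> f z + b + L / 2 * (norm (y - z))\<^sup>2"
    if b: "\<Psi> z = ereal b" for b
  proof -
    have "a + (L *\<^sub>R (y - p) - G y) \<bullet> (z - p) \<le> b"
      using prox_grad_step_subgradient[OF L_pos, of y z] a b by (simp add: p_def)
    moreover have "f p \<le> f y + G y \<bullet> (p - y) + L / 2 * (norm (p - y))\<^sup>2"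
      by (rule lipschitz_gradient_le[OF f_gradient G_lipschitz])
    moreover have "f y + G y \<bullet> (z - y) \<le> f z"
      by (rule convex_on_ge_linearization[OF f_convex f_gradient])
    moreover have "L / 2 * (norm (y - z))\<^sup>2
        = L / 2 * (norm (p - y))\<^sup>2 - L *\<^sub>R (y - p) \<bullet> (z - p) + L / 2 * (norm (z - p))\<^sup>2"
      unfolding power2_norm_eq_inner by (simp add: inner_commute algebra_simps)
    moreover have "(L *\<^sub>R (y - p) - G y) \<bullet> (z - p)
        = L *\<^sub>R (y - p) \<bullet> (z - p) - (G y \<bullet> (z - y) - G y \<bullet> (p - y))"
      by (simp add: algebra_simps)
    ultimately show ?thesis
      by linarith
  qed
  then show ?thesis
    using a \<Psi>_proper unfolding p_def[symmetric] objective_def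
    by (cases "\<Psi> z") (auto simp: ereal_proper_def)
qed

lemma solution_finite:
  assumes "z \<in> solution_set G \<Psi>"
  shows "\<bar>objective f \<Psi> z\<bar> \<noteq> \<infinity>"
proof -
  have "\<bar>\<Psi> z\<bar> \<noteq> \<infinity>"
    using prox_grad_step_finite[of 1 z] assms by (simp add: solution_set_iff)
  then show ?thesis
    by (cases "\<Psi> z") (auto simp: objective_def)
qed

lemma solution_subgradient:
  assumes "z \<in> solution_set G \<Psi>"
  shows "\<Psi> z + ereal (- G z \<bullet> (w - z)) \<le> \<Psi> w"
  using prox_grad_step_subgradient[of 1 z w] assms by (simp add: solution_set_iff)

text \<open>The fixed-point equation makes \<open>- G z\<close> a subgradient of \<Psi> at
  \<open>z\<close>; it cancels the gradient in the tangent inequality for \<open>f\<close>.\<close>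

lemma solution_minimizes:
  assumes "z \<in> solution_set G \<Psi>"
  shows "objective f \<Psi> z \<le> objective f \<Psi> w"
  using solution_subgradient[OF assms, of w] solution_finite[OF assms]
    convex_on_ge_linearization[OF f_convex f_gradient, of z w]
  by (cases "\<Psi> z"; cases "\<Psi> w") (auto simp: objective_def)

text \<open>In the three-point inequality at a solution, minimality removes the objective values and
  leaves the squared distances.\<close>

lemma prox_grad_step_closer_to_solution:
  assumes "z \<in> solution_set G \<Psi>"
  shows "norm (z - prox_grad_step G \<Psi> L y) \<le> norm (y - z)"
proof -
  define p where "p = prox_grad_step G \<Psi> L y"
  obtain a where "objective f \<Psi> z = ereal a"
    using solution_finite[OF assms] by auto
  moreover obtain b where "objective f \<Psi> p = ereal b"
    using prox_grad_step_finite[OF L_pos, of y] by (auto simp: p_def objective_def)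
  ultimately have "L / 2 * (norm (z - p))\<^sup>2 \<le> L / 2 * (norm (y - z))\<^sup>2"
    using objective_prox_grad_step_le[of y z] solution_minimizes[OF assms, of p]
    by (simp add: p_def)
  then show ?thesis
    using L_pos by (simp add: p_def)
qed

text \<open>Compares the steps with parameters \<open>1\<close> and \<open>L\<close>. Adding the two
  subgradient inequalities, each tested at the other point, eliminates \<open>G x\<close>;
  Cauchy-Schwarz then gives the factor.\<close>

lemma residual_le_norm_prox_grad_step:
  "residual G \<Psi> x \<le> (1 + L) * norm (x - prox_grad_step G \<Psi> L x)"
proof -
  define p q where "p = prox_grad_step G \<Psi> 1 x" and "q = prox_grad_step G \<Psi> L x"
  obtain a b where "\<Psi> p = ereal a" "\<Psi> q = ereal b"
    using prox_grad_step_finite[of 1 x] prox_grad_step_finite[OF L_pos, of x]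
    by (auto simp: p_def q_def)
  then have "(x - p - G x) \<bullet> (q - p) + (L *\<^sub>R (x - q) - G x) \<bullet> (p - q) \<le> 0"
    using prox_grad_step_subgradient[of 1 x q] prox_grad_step_subgradient[OF L_pos, of x p]
    by (simp add: p_def q_def)
  moreover have "(x - p - G x) \<bullet> (q - p) + (L *\<^sub>R (x - q) - G x) \<bullet> (p - q)
      = (norm (x - p))\<^sup>2 + L * (norm (x - q))\<^sup>2 - (1 + L) * ((x - p) \<bullet> (x - q))"
    unfolding power2_norm_eq_inner by (simp add: inner_commute algebra_simps)
  moreover have "0 \<le> L * (norm (x - q))\<^sup>2"
    using L_pos by simp
  moreover have "(1 + L) * ((x - p) \<bullet> (x - q)) \<le> (1 + L) * (norm (x - p) * norm (x - q))"
    using L_pos by (intro mult_left_mono norm_cauchy_schwarz) auto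
  ultimately have "norm (x - p) * norm (x - p) \<le> norm (x - p) * ((1 + L) * norm (x - q))"
    by (simp add: power2_eq_square mult_ac)
  then have "norm (x - p) \<le> (1 + L) * norm (x - q)"
    using L_pos by (cases "norm (x - p) = 0") (auto simp: mult_le_cancel_left)
  then show ?thesis
    by (simp add: residual_eq p_def q_def)
qed

text \<open>The same exchange, now between the unit step \<open>p\<close> and the solution, bounds
  the distance from \<open>p\<close> to \<open>z\<close> by (1 + L) times that from
  \<open>x\<close>. The triangle inequality adds one more.\<close>

lemma residual_le_dist_solution:
  assumes "z \<in> solution_set G \<Psi>"
  shows "residual G \<Psi> x \<le> (2 + L) * dist x z"
proof -
  define p where "p = prox_grad_step G \<Psi> 1 x"
  obtain a where "\<Psi> p = ereal a"
    using prox_grad_step_finite[of 1 x] by (auto simp: p_def)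
  moreover obtain b where "\<Psi> z = ereal b"
    using prox_grad_step_finite[of 1 z] assms by (auto simp: solution_set_iff)
  ultimately have "(x - p - G x) \<bullet> (z - p) + (- G z) \<bullet> (p - z) \<le> 0"
    using prox_grad_step_subgradient[of 1 x z] solution_subgradient[OF assms, of p]
    by (simp add: p_def)
  moreover have "(x - p - G x) \<bullet> (z - p) + (- G z) \<bullet> (p - z)
      = (norm (p - z))\<^sup>2 - (x - z - (G x - G z)) \<bullet> (p - z)"
    unfolding power2_norm_eq_inner by (simp add: inner_commute algebra_simps)
  moreover have "(x - z - (G x - G z)) \<bullet> (p - z) \<le> norm (x - z - (G x - G z)) * norm (p - z)"
    by (rule norm_cauchy_schwarz)
  moreover have "norm (x - z - (G x - G z)) \<le> (1 + L) * norm (x - z)"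
    using norm_triangle_ineq4[of "x - z" "G x - G z"] lipschitz_onD[OF G_lipschitz, of x z]
    by (simp add: dist_norm algebra_simps)
  then have "norm (x - z - (G x - G z)) * norm (p - z) \<le> (1 + L) * norm (x - z) * norm (p - z)"
    by (intro mult_right_mono) auto
  ultimately have "norm (p - z) * norm (p - z) \<le> norm (p - z) * ((1 + L) * norm (x - z))"
    by (simp add: power2_eq_square mult_ac)
  then have "norm (p - z) \<le> (1 + L) * norm (x - z)"
    using L_pos by (cases "norm (p - z) = 0") (auto simp: mult_le_cancel_left)
  then show ?thesis
    using norm_triangle_ineq4[of "x - z" "p - z"]
    by (simp add: residual_eq p_def dist_norm algebra_simps)
qed

lemma residual_le_infdist:
  assumes "solution_set G \<Psi> \<noteq> {}"
  shows "residual G \<Psi> x \<le> (2 + L) * infdist x (solution_set G \<Psi>)"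
proof -
  have "residual G \<Psi> x / (2 + L) \<le> infdist x (solution_set G \<Psi>)"
    unfolding infdist_notempty[OF assms]
    using assms residual_le_dist_solution[of _ x] L_pos
    by (intro cINF_greatest) (auto simp: field_simps)
  then show ?thesis
    using L_pos by (simp add: field_simps)
qed

text \<open>One step from \<open>x\<close> lowers the objective by at least L/2 times its squared
  length, and it still lands at or above the minimum.\<close>

lemma objective_residual_growth:
  assumes "z \<in> solution_set G \<Psi>"
  shows "objective f \<Psi> z + ereal (L / 2 * (residual G \<Psi> x / (1 + L))\<^sup>2) \<le> objective f \<Psi> x"
proof -
  let ?p = "prox_grad_step G \<Psi> L x"
  have "residual G \<Psi> x / (1 + L) \<le> norm (x - ?p)"
    using residual_le_norm_prox_grad_step[of x] L_pos by (simp add: field_simps)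
  then have "(residual G \<Psi> x / (1 + L))\<^sup>2 \<le> (norm (x - ?p))\<^sup>2"
    using L_pos by (intro power_mono) (auto simp: residual_def)
  then have "objective f \<Psi> z + ereal (L / 2 * (residual G \<Psi> x / (1 + L))\<^sup>2)
      \<le> objective f \<Psi> ?p + ereal (L / 2 * (norm (x - ?p))\<^sup>2)"
    using L_pos by (intro add_mono solution_minimizes[OF assms]) auto
  also have "\<dots> \<le> objective f \<Psi> x"
    using objective_prox_grad_step_le[of x x] by simp
  finally show ?thesis .
qed

end

section \<open>Acceptance of unit steps and superlinear convergence\<close>

theorem corollary3p4:
  fixes f :: "'a::{real_inner, complete_space} \<Rightarrow> real"
    and G :: "'a \<Rightarrow> 'a"
    and \<Psi> :: "'a \<Rightarrow> ereal"
    and L \<kappa> \<epsilon> \<beta> \<gamma> \<delta> :: real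
    and x xt :: "nat \<Rightarrow> 'a"
    and \<alpha> :: "nat \<Rightarrow> real"
  defines "F \<equiv> objective f \<Psi>"
    and "r \<equiv> residual G \<Psi>"
    and "S \<equiv> solution_set G \<Psi>"
  defines "Fstar \<equiv> (INF z. F z)"
    and "d \<equiv> (\<lambda>t. infdist (x t) S)"
  assumes f_convex: "convex_on UNIV f"
    and f_gradient: "\<And>z. GDERIV f z :> G z"
    and L_pos: "L > 0"
    and G_lipschitz: "L-lipschitz_on UNIV G"
    and \<Psi>_convex: "ereal_convex \<Psi>"
    and \<Psi>_proper: "ereal_proper \<Psi>"
    and \<Psi>_closed: "ereal_closed \<Psi>"
    and S_nonempty: "S \<noteq> {}"
    and \<kappa>_pos: "\<kappa> > 0"
    and \<epsilon>_pos: "\<epsilon> > 0"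
    and error_bound: "\<And>z. r z \<le> \<epsilon> \<Longrightarrow> infdist z S \<le> \<kappa> * r z"
    and \<beta>: "0 < \<beta>" "\<beta> < 1"
    and \<gamma>: "0 < \<gamma>" "\<gamma> < 1"
    and \<delta>_pos: "\<delta> > 0"
    and run: "line_search_run f G \<Psi> L \<beta> \<gamma> \<delta> x xt \<alpha>"
    and tentative_dist: "little_o (\<lambda>t. ereal (infdist (xt (Suc t)) S)) (\<lambda>t. ereal (d t))"
    and tentative_residual: "little_o (\<lambda>t. ereal (r (xt (Suc t)))) (\<lambda>t. ereal (r (x t)))"
    and tentative_step:
      "little_o (\<lambda>t. ereal (norm (xt (Suc t) - x t) powr (2 + \<delta>))) (\<lambda>t. ereal ((d t)\<^sup>2))"
  shows "(\<forall>\<^sub>F t in sequentially. \<alpha> t = 1) \<and>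
         little_o (\<lambda>t. ereal (d (Suc t))) (\<lambda>t. ereal (d t)) \<and>
         little_o (\<lambda>t. ereal (r (x (Suc t)))) (\<lambda>t. ereal (r (x t))) \<and>
         little_o (\<lambda>t. F (x (Suc t)) - Fstar) (\<lambda>t. F (x t) - Fstar)"
proof -
  interpret convex_composite f G \<Psi> L
    using f_convex f_gradient L_pos G_lipschitz \<Psi>_convex \<Psi>_proper \<Psi>_closed
    by unfold_locales
  define p where "p t = xt (Suc t) - x t" for t
  define T where "T t = prox_grad_step G \<Psi> L (xt (Suc t))" for t
  obtain z0 where z0: "z0 \<in> S"
    using S_nonempty by blast
  obtain \<phi> where \<phi>: "F z0 = ereal \<phi>"
    using solution_finite z0 unfolding F_def S_def by (metis ereal_infinity_cases abs_ereal.simps(2,3) ereal_cases)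
  \<comment> \<open>The nearby solution used below varies with \<open>t\<close>; all solutions have
    to give the same reference value \<phi>.\<close>
  have F_solution: "F z = ereal \<phi>" if "z \<in> S" for z
    using solution_minimizes[of z z0] solution_minimizes[of z0 z] that z0 \<phi>
    by (simp add: F_def S_def order_antisym)
  have Fstar: "Fstar = ereal \<phi>"
    using solution_minimizes z0 \<phi> unfolding Fstar_def F_def S_def
    by (metis INF_eqI UNIV_I)
  have p_nz: "p t \<noteq> 0" for t
    using run by (simp add: line_search_run_def Let_def p_def)
  have dist_o: "\<forall>\<^sub>F t in sequentially. infdist (xt (Suc t)) S \<le> c * d t" if "c > 0" for c
    using tentative_dist that by (simp add: little_o_def)
  have step_o: "\<forall>\<^sub>F t in sequentially. norm (p t) powr (2 + \<delta>) \<le> c * (d t)\<^sup>2" if "c > 0" for c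
    using tentative_step that by (simp add: little_o_def p_def)
  \<comment> \<open>A nonzero step cannot be bounded by a multiple of a zero distance. Positivity
    supplies the strict slack between c/2 and c times \<open>d t\<close> in
    \<open>near\<close>.\<close>
  have d_pos: "\<forall>\<^sub>F t in sequentially. d t > 0"
    using step_o[OF zero_less_one]
  proof eventually_elim
    case (elim t)
    have "0 < norm (p t) powr (2 + \<delta>)"
      using p_nz by simp
    with elim have "d t \<noteq> 0"
      by auto
    then show ?case
      using infdist_nonneg[of "x t" S] by (simp add: d_def)
  qed
  have near: "\<forall>\<^sub>F t in sequentially. \<exists>z\<in>S. dist (xt (Suc t)) z \<le> c * d t" if "c > 0" for c
    using dist_o[OF half_gt_zero[OF that]] d_pos
  proof eventually_elim
    case (elim t)
    have "c / 2 * d t < c * d t"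
      using elim that by simp
    with elim have "infdist (xt (Suc t)) S < c * d t"
      by simp
    then show ?case
      using S_nonempty by (elim infdist_lessE) (auto intro: less_imp_le)
  qed
  have r_le_d: "r y \<le> (2 + L) * infdist y S" for y
    using residual_le_infdist S_nonempty by (simp add: r_def S_def)

  have d_le_r: "\<forall>\<^sub>F t in sequentially. d t \<le> \<kappa> * r (x t)"
  proof -
    \<comment> \<open>Chosen so that a distance of at most 2 * \<eta> forces a residual of at most
      \<epsilon>, where the error bound applies.\<close>
    define \<eta> where "\<eta> = \<epsilon> / (2 * (2 + L))"
    have \<eta>: "\<eta> > 0"
      using \<epsilon>_pos L_pos by (simp add: \<eta>_def)
    have "\<forall>\<^sub>F t in sequentially. infdist (xt (Suc t)) S \<le> 1 / 2 * d t"
      by (rule dist_o) simp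
    \<comment> \<open>The 4 offsets the square of the 2 in \<open>d t \<le> 2 * norm (p t)\<close>.
      Cancelling the squared norm then leaves a comparison of powers with exponent \<delta>.\<close>
    moreover have "\<forall>\<^sub>F t in sequentially. norm (p t) powr (2 + \<delta>) \<le> \<eta> powr \<delta> / 4 * (d t)\<^sup>2"
      using \<eta> by (intro step_o) simp
    ultimately show ?thesis
    proof eventually_elim
      case (elim t)
      have "d t \<le> infdist (xt (Suc t)) S + norm (p t)"
        using infdist_triangle[of "x t" S "xt (Suc t)"]
        by (simp add: d_def p_def dist_norm norm_minus_commute)
      with elim have d: "d t \<le> 2 * norm (p t)"
        by simp
      have "(d t)\<^sup>2 \<le> (2 * norm (p t))\<^sup>2"
        using d by (intro power_mono) (auto simp: d_def infdist_nonneg)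
      then have "\<eta> powr \<delta> / 4 * (d t)\<^sup>2 \<le> \<eta> powr \<delta> / 4 * (2 * norm (p t))\<^sup>2"
        by (intro mult_left_mono) auto
      note step = order_trans[OF elim(2) this]
      have "norm (p t) powr \<delta> * (norm (p t))\<^sup>2 = norm (p t) powr (2 + \<delta>)"
        using p_nz by (simp add: powr_add)
      also have "\<dots> \<le> \<eta> powr \<delta> / 4 * (2 * norm (p t))\<^sup>2"
        by (rule step)
      finally have "norm (p t) powr \<delta> \<le> \<eta> powr \<delta>"
        using p_nz[of t] by (simp add: power_mult_distrib)
      then have "norm (p t) \<le> \<eta>"
        using \<delta>_pos \<eta> by (metis norm_ge_zero not_le powr_less_mono2 less_imp_le)
      with d have "d t \<le> 2 * \<eta>"
        by simp
      then have "r (x t) \<le> (2 + L) * (2 * \<eta>)"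
        using L_pos by (intro order_trans[OF r_le_d] mult_left_mono) (auto simp: d_def)
      also have "\<dots> = \<epsilon>"
        using L_pos by (simp add: \<eta>_def field_simps)
      finally show ?case
        using error_bound by (simp add: d_def)
    qed
  qed

  \<comment> \<open>The constant that results from \<open>objective_residual_growth\<close> when the
    residual is bounded below by \<open>d t / \<kappa>\<close>.\<close>
  define q where "q = L / 2 * (1 / ((1 + L) * \<kappa>))\<^sup>2"
  have q: "q > 0"
    using L_pos \<kappa>_pos by (simp add: q_def)
  have growth: "\<forall>\<^sub>F t in sequentially. ereal (\<phi> + q * (d t)\<^sup>2) \<le> F (x t)"
    using d_le_r
  proof eventually_elim
    case (elim t)
    have "d t / ((1 + L) * \<kappa>) = d t / \<kappa> / (1 + L)"
      by (simp only: divide_divide_eq_left mult.commute)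
    also have "\<dots> \<le> r (x t) / (1 + L)"
      using elim L_pos \<kappa>_pos by (intro divide_right_mono) (auto simp: pos_divide_le_eq mult.commute)
    finally have "d t / ((1 + L) * \<kappa>) \<le> r (x t) / (1 + L)" .
    then have "(d t / ((1 + L) * \<kappa>))\<^sup>2 \<le> (r (x t) / (1 + L))\<^sup>2"
      using L_pos \<kappa>_pos by (intro power_mono) (auto simp: d_def infdist_nonneg)
    then have "L / 2 * (d t / ((1 + L) * \<kappa>))\<^sup>2 \<le> L / 2 * (r (x t) / (1 + L))\<^sup>2"
      using L_pos by (intro mult_left_mono) auto
    then have "q * (d t)\<^sup>2 \<le> L / 2 * (r (x t) / (1 + L))\<^sup>2"
      by (simp add: q_def power_divide)
    then have "ereal (\<phi> + q * (d t)\<^sup>2) \<le> F z0 + ereal (L / 2 * (r (x t) / (1 + L))\<^sup>2)"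
      by (simp add: \<phi>)
    also have "\<dots> \<le> F (x t)"
      using objective_residual_growth z0 by (simp add: F_def S_def r_def)
    finally show ?case .
  qed
  have F_T: "\<forall>\<^sub>F t in sequentially. F (T t) \<le> ereal (\<phi> + c * (d t)\<^sup>2)" if c: "c > 0" for c
  proof -
    \<comment> \<open>The square of this factor, times L/2, is exactly \<open>c\<close>.\<close>
    have "\<forall>\<^sub>F t in sequentially. \<exists>z\<in>S. dist (xt (Suc t)) z \<le> sqrt (2 * c / L) * d t"
      using c L_pos by (intro near) simp
    then show ?thesis
    proof eventually_elim
      case (elim t)
      then obtain z where z: "z \<in> S" "dist (xt (Suc t)) z \<le> sqrt (2 * c / L) * d t"
        by blast
      have "(norm (xt (Suc t) - z))\<^sup>2 \<le> (sqrt (2 * c / L) * d t)\<^sup>2"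
        using z(2) by (intro power_mono) (auto simp: dist_norm)
      then have "L / 2 * (norm (xt (Suc t) - z))\<^sup>2 \<le> c * (d t)\<^sup>2"
        using c L_pos by (simp add: power_mult_distrib field_simps)
      moreover have "F (T t) + ereal (L / 2 * (norm (z - T t))\<^sup>2)
          \<le> ereal (\<phi> + L / 2 * (norm (xt (Suc t) - z))\<^sup>2)"
        using objective_prox_grad_step_le[of "xt (Suc t)" z] F_solution[OF z(1)]
        by (simp add: F_def T_def)
      moreover have "0 \<le> L / 2 * (norm (z - T t))\<^sup>2"
        using L_pos by simp
      ultimately show ?case
        by (cases "F (T t)") auto
    qed
  qed

  have \<alpha>: "\<forall>\<^sub>F t in sequentially. \<alpha> t = 1"
    \<comment> \<open>The growth q * d^2 is split in half: one part covers the gap at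
      \<open>T t\<close>, the other the decrease demanded by the line search.\<close>
    using F_T[OF half_gt_zero[OF q]] growth step_o[OF half_gt_zero[OF q]]
  proof eventually_elim
    case (elim t)
    have "\<gamma> * norm (p t) powr (2 + \<delta>) \<le> 1 * norm (p t) powr (2 + \<delta>)"
      using \<gamma> by (intro mult_right_mono) auto
    with elim q have "\<phi> + q / 2 * (d t)\<^sup>2 \<le> \<phi> + q * (d t)\<^sup>2 - \<gamma> * norm (p t) powr (2 + \<delta>)"
      by simp
    with elim q have "F (T t) \<le> F (x t) - ereal (\<gamma> * norm (p t) powr (2 + \<delta>))"
      by (cases "F (x t)"; cases "F (T t)") auto
    then have "step_accepted f G \<Psi> L \<gamma> \<delta> (x t) (p t) (\<beta> ^ 0)"
      by (simp add: step_accepted_def trial_point_def F_def T_def p_def)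
    \<comment> \<open>Every exponent below \<open>k\<close> was rejected, so acceptance at exponent
      0 forces \<open>k = 0\<close>.\<close>
    moreover obtain k where k: "\<alpha> t = \<beta> ^ k"
      "\<And>j. j < k \<Longrightarrow> \<not> step_accepted f G \<Psi> L \<gamma> \<delta> (x t) (p t) (\<beta> ^ j)"
      using run unfolding line_search_run_def Let_def p_def by blast
    ultimately have "\<not> 0 < k"
      by blast
    with k(1) show ?case
      by simp
  qed
  have x_Suc: "\<forall>\<^sub>F t in sequentially. x (Suc t) = T t"
    using \<alpha>
  proof eventually_elim
    case (elim t)
    then show ?case
      using run by (simp add: line_search_run_def Let_def trial_point_def T_def)
  qed
  have d_o: "\<forall>\<^sub>F t in sequentially. d (Suc t) \<le> c * d t" if "c > 0" for c
    using x_Suc near[OF that]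
  proof eventually_elim
    case (elim t)
    then obtain z where z: "z \<in> S" "dist (xt (Suc t)) z \<le> c * d t"
      by blast
    have "d (Suc t) \<le> dist (T t) z"
      using elim z by (simp add: d_def infdist_le)
    also have "\<dots> \<le> dist (xt (Suc t)) z"
      using prox_grad_step_closer_to_solution[of z "xt (Suc t)"] z
      by (simp add: T_def S_def dist_norm norm_minus_commute)
    finally show ?case
      using z by simp
  qed
  have r_o: "\<forall>\<^sub>F t in sequentially. r (x (Suc t)) \<le> c * r (x t)" if c: "c > 0" for c
  proof -
    \<comment> \<open>The denominator cancels the factor 2 + L from residual to distance and the
      \<kappa> from distance back to residual.\<close>
    have "\<forall>\<^sub>F t in sequentially. d (Suc t) \<le> c / ((2 + L) * \<kappa>) * d t"
      using c L_pos \<kappa>_pos by (intro d_o) simp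
    with d_le_r show ?thesis
    proof eventually_elim
      case (elim t)
      have "r (x (Suc t)) \<le> (2 + L) * d (Suc t)"
        using r_le_d by (simp add: d_def)
      also have "\<dots> \<le> (2 + L) * (c / ((2 + L) * \<kappa>) * (\<kappa> * r (x t)))"
        using elim c L_pos \<kappa>_pos
        by (intro mult_left_mono order_trans[OF elim(2)]) auto
      finally show ?case
        using L_pos \<kappa>_pos by simp
    qed
  qed
  \<comment> \<open>\<open>F_T\<close> is used with \<open>c * q\<close>, since
    \<open>growth\<close> bounds the gap at \<open>x t\<close> below by q * d^2.\<close>
  have F_o: "\<forall>\<^sub>F t in sequentially. F (x (Suc t)) - Fstar \<le> ereal c * (F (x t) - Fstar)"
    if c: "c > 0" for c
    using x_Suc F_T[OF mult_pos_pos[OF c q]] growth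
  proof eventually_elim
    case (elim t)
    have "F (x (Suc t)) - Fstar \<le> ereal (c * (q * (d t)\<^sup>2))"
      using elim mult_pos_pos[OF c q] unfolding Fstar by (cases "F (T t)") (auto simp: mult_ac)
    also have "\<dots> = ereal c * ereal (q * (d t)\<^sup>2)"
      by simp
    also have "\<dots> \<le> ereal c * (F (x t) - Fstar)"
      using elim c unfolding Fstar
      by (intro ereal_mult_left_mono) (cases "F (x t)"; auto)+
    finally show ?case .
  qed
  show ?thesis
    using \<alpha> d_o r_o F_o by (simp add: little_o_def)
qed

end
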